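(* Let $\mathcal{T}=(F,R,>)$ be a defeasible theory over the signature $\Sigma$ (consisting only of constant symbols and $=$), let $\mathcal{D}$ be a $\Sigma$-structure (domain), and let $c$ be a conclusion (one of $+\Delta q$, $-\Delta q$, $+\partial q$, $-\partial q$ for a ground literal $q$). If $\mathcal{T}\vdash c$, then $Th(\mathcal{D}),\mathcal{T}\models_{DL} c$.
   Context: Signatures and theories. $\Sigma$ is a signature containing only constant symbols and the equality symbol $=$; $\Pi$ is a separate set of predicate symbols with arities. An atom is $p(t_1,\dots,t_n)$ with $p\in\Pi$ of arity $n$ and terms $t_i$; a literal is $a$ or $\neg a$ for an atom $a$. For a literal $q$, $\sim q$ denotes the complementary literal ($\sim p=\neg p$, $\sim\neg p=p$). A rule $r$ has a label, an antecedent $A(r)$ (a finite set of literals), a head (a literal), and is of one of three kinds: strict ($\to$), defeasible ($\Rightarrow$), or defeater ($\leadsto$). A defeasible theory is $\mathcal{T}=(F,R,>)$ with $F$ a finite set of literals (facts), $R$ a finite set of rules, and $>$ an acyclic binary relation (superiority) on labels of $R$. Rules with variables are treated as schemas standing for all their ground instances (variables replaced by constants), so $F$ and $R$ consist of ground literals and ground rules. For a set $R$ of rules: $R_s$ = strict rules, $R_{sd}$ = strict and defeasible rules, $R[q]$ = rules in $R$ with head $q$. Proof theory. A conclusion is a tagged literal $+\Delta q$, $-\Delta q$, $+\partial q$ or $-\partial q$. A derivation is a finite sequence $P=(P(1),\dots,P(n))$ of conclusions where each $P(i+1)$ is justified by one of the following rules ($P(1..i)$ is the initial segment of length $i$): $+\Delta$: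 append $+\Delta q$ if $q\in F$ or $\exists r\in R_s[q]\,\forall a\in A(r): +\Delta a\in P(1..i)$. $-\Delta$: append $-\Delta q$ if $q\notin F$ and $\forall r\in R_s[q]\,\exists a\in A(r): -\Delta a\in P(1..i)$. $+\partial$: append $+\partial q$ if (1) $+\Delta q\in P(1..i)$, or (2) (2.1) $\exists r\in R_{sd}[q]\,\forall a\in A(r): +\partial a\in P(1..i)$ and (2.2) $-\Delta\sim q\in P(1..i)$ and (2.3) for every $s\in R[\sim q]$ either (2.3.1) $\exists a\in A(s): -\partial a\in P(1..i)$ or (2.3.2) $\exists t\in R_{sd}[q]$ with $\forall a\in A(t): +\partial a\in P(1..i)$ and $t>s$. $-\partial$: append $-\partial q$ if (1) $-\Delta q\in P(1..i)$ and (2) either (2.1) $\forall r\in R_{sd}[q]\,\exists a\in A(r): -\partial a\in P(1..i)$, or (2.2) $+\Delta\sim q\in P(1..i)$, or (2.3) $\exists s\in R[\sim q]$ such that (2.3.1) $\forall a\in A(s): +\partial a\in P(1..i)$ and (2.3.2) for every $t\in R_{sd}[q]$ either $\exists a\in A(t): -\partial a\in P(1..i)$ or not $t>s$. $\mathcal{T}\vdash c$ means some derivation in $\mathcal{T}$ ends with $c$. Model theory. A domain is a $\Sigma$-structure $\mathcal{D}$ with carrier $D$, interpreting $=$ as identity. Its base is $B_{\mathcal{D}}=\{p(d_1,\dots,d_n),\neg p(d_1,\dots,d_n): p\in\Pi \text{ of arity } n, d_i\in D\}$. Ground literals of $\mathcal{T}$ denote elements of $B_{\mathcal{D}}$ by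 interpreting constants in $\mathcal{D}$; accordingly, for $q\in B_{\mathcal{D}}$, "$q\in F$" means some fact denotes $q$, and $R[q]$ is the set of rules whose head denotes $q$ (with antecedents interpreted likewise). A defeasible interpretation $\mathcal{I}$ consists of a domain $\mathcal{D}_{\mathcal{I}}$ and two partial functions $\mathcal{I}_\Delta,\mathcal{I}_\partial: B_{\mathcal{D}_\mathcal{I}}\to\{True,False\}$ such that for all $q$: $\mathcal{I}_\Delta(q)=True\Rightarrow\mathcal{I}_\partial(q)=True$ and $\mathcal{I}_\partial(q)=False\Rightarrow\mathcal{I}_\Delta(q)=False$. These are extended to finite sets (conjunctions) of literals by the Kleene strong three-valued conjunction (True if all conjuncts True, False if some conjunct False, undefined otherwise; the empty conjunction is True). A $\mathcal{D}$-interpretation $\mathcal{I}$ is a $\mathcal{D}$-model of $\mathcal{T}$ if for all $q\in B_{\mathcal{D}}$: $\mathcal{I}_\Delta(q)=True$ iff $q\in F$ or $\exists r\in R_s[q]:\mathcal{I}_\Delta(A(r))=True$; $\mathcal{I}_\Delta(q)=False$ iff $q\notin F$ and $\forall r\in R_s[q]:\mathcal{I}_\Delta(A(r))=False$; $\mathcal{I}_\partial(q)=True$ iff (1) $\mathcal{I}_\Delta(q)=True$ or (2) [$\exists r\in R_{sd}[q]:\mathcal{I}_\partial(A(r))=True$ and $\mathcal{I}_\Delta(\sim q)=False$ and for all $s\in R[\sim q]$ either $\mathcal{I}_\partial(A(s))=False$ or $\exists t\in R_{sd}[q]$ with $\mathcal{I}_\partial(A(t))=True$ and $t>s$]; $\mathcal{I}_\partial(q)=False$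 iff (1) $\mathcal{I}_\Delta(q)=False$ and (2) [$\forall r\in R_{sd}[q]:\mathcal{I}_\partial(A(r))=False$, or $\mathcal{I}_\Delta(\sim q)=True$, or $\exists s\in R[\sim q]$ with $\mathcal{I}_\partial(A(s))=True$ and for all $t\in R_{sd}[q]$ either $\mathcal{I}_\partial(A(t))=False$ or not $t>s$]. $Th(\mathcal{D})$ is the first-order theory of $\mathcal{D}$. $Th(\mathcal{D}),\mathcal{T}\models_{DL} c$ means: for every defeasible model $M$ of $\mathcal{T}$ whose domain $\mathcal{D}_M$ is a model of $Th(\mathcal{D})$, $c$ holds in $M$, where $+\Delta q$ holds iff $M_\Delta(q)=True$, $-\Delta q$ iff $M_\Delta(q)=False$, $+\partial q$ iff $M_\partial(q)=True$, $-\partial q$ iff $M_\partial(q)=False$ (with $q$ interpreted in $\mathcal{D}_M$).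
   Formalization: For conclusions other than +Δq, it is additionally assumed that D interprets distinct constants occurring in c or in ground instances of T as distinct elements; otherwise the claim fails (F={p(b)}, no rules, a=b in D: −Δp(a) is derivable but p(a) is true). *)

theory Defs
  imports Main
begin

section \<open>First-order logic over constants and equality\<close>

text \<open>A signature is given by its set \<open>C\<close> of constant symbols; equality is built in.\<close>

datatype 'c trm = Var nat | Const 'c

definition terms_over :: "'c set \<Rightarrow> 'c trm set" where
  "terms_over C = range Var \<union> Const ` C"

datatype (fm_consts: 'c) fm =
    FEqual "'c trm" "'c trm"
  | FNot "'c fm"
  | FAnd "'c fm" "'c fm"
  | FAll nat "'c fm"

fun trm_vars :: "'c trm \<Rightarrow> nat set" where
  "trm_vars (Var x) = {x}"
| "trm_vars (Const a) = {}"

fun free_vars :: "'c fm \<Rightarrow> nat set" where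
  "free_vars (FEqual s t) = trm_vars s \<union> trm_vars t"
| "free_vars (FNot \<phi>) = free_vars \<phi>"
| "free_vars (FAnd \<phi> \<psi>) = free_vars \<phi> \<union> free_vars \<psi>"
| "free_vars (FAll x \<phi>) = free_vars \<phi> - {x}"

definition sentences :: "'c set \<Rightarrow> 'c fm set" where
  "sentences C = {\<phi>. fm_consts \<phi> \<subseteq> C \<and> free_vars \<phi> = {}}"

record ('c, 'd) struct =
  carrier :: "'d set"
  interp :: "'c \<Rightarrow> 'd"

definition is_struct :: "'c set \<Rightarrow> ('c, 'd) struct \<Rightarrow> bool" where
  "is_struct C D \<longleftrightarrow> carrier D \<noteq> {} \<and> (\<forall>a\<in>C. interp D a \<in> carrier D)"

fun trm_val :: "('c, 'd) struct \<Rightarrow> (nat \<Rightarrow> 'd) \<Rightarrow> 'c trm \<Rightarrow> 'd" where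
  "trm_val D e (Var x) = e x"
| "trm_val D e (Const a) = interp D a"

fun sat :: "('c, 'd) struct \<Rightarrow> (nat \<Rightarrow> 'd) \<Rightarrow> 'c fm \<Rightarrow> bool" where
  "sat D e (FEqual s t) \<longleftrightarrow> trm_val D e s = trm_val D e t"
| "sat D e (FNot \<phi>) \<longleftrightarrow> \<not> sat D e \<phi>"
| "sat D e (FAnd \<phi> \<psi>) \<longleftrightarrow> sat D e \<phi> \<and> sat D e \<psi>"
| "sat D e (FAll x \<phi>) \<longleftrightarrow> (\<forall>d\<in>carrier D. sat D (e(x := d)) \<phi>)"

definition satisfies :: "('c, 'd) struct \<Rightarrow> 'c fm \<Rightarrow> bool" where
  "satisfies D \<phi> \<longleftrightarrow> (\<forall>e. (\<forall>x. e x \<in> carrier D) \<longrightarrow> sat D e \<phi>)"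

definition Th :: "'c set \<Rightarrow> ('c, 'd) struct \<Rightarrow> 'c fm set" where
  "Th C D = {\<phi> \<in> sentences C. satisfies D \<phi>}"


section \<open>Literals, rules and defeasible theories\<close>

text \<open>
  The type \<open>'p\<close> is the set of predicate symbols. Everything is parametric in the type \<open>'a\<close> of
  arguments: terms for literals that may contain variables, constants for ground literals, and
  domain elements for members of the base of a domain.
\<close>

datatype ('p, args: 'a) lit = Pos 'p "'a list" | Neg 'p "'a list"

fun compl :: "('p, 'a) lit \<Rightarrow> ('p, 'a) lit" where
  "compl (Pos p ts) = Neg p ts"
| "compl (Neg p ts) = Pos p ts"

definition lits_over :: "('p \<Rightarrow> nat) \<Rightarrow> 'a set \<Rightarrow> ('p, 'a) lit set" where
  "lits_over ar X =
     {Pos p ts | p ts. length ts = ar p \<and> set ts \<subseteq> X} \<union>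
     {Neg p ts | p ts. length ts = ar p \<and> set ts \<subseteq> X}"

abbreviation (input) ground_lits :: "('p \<Rightarrow> nat) \<Rightarrow> 'c set \<Rightarrow> ('p, 'c) lit set" where
  "ground_lits ar C \<equiv> lits_over ar C"

abbreviation (input) base :: "('p \<Rightarrow> nat) \<Rightarrow> ('c, 'd) struct \<Rightarrow> ('p, 'd) lit set" where
  "base ar D \<equiv> lits_over ar (carrier D)"

datatype kind = Strict | Defeasible | Defeater

datatype ('l, 'p, 'a) rule =
  Rule (label: 'l) (kind: kind) (antecedent: "('p, 'a) lit set") (head: "('p, 'a) lit")

text \<open>A pair \<open>(k, l)\<close> in the superiority relation means that \<open>k\<close> is superior to \<open>l\<close>.\<close>

record ('l, 'p, 'a) dtheory =
  facts :: "('p, 'a) lit set"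
  rules :: "('l, 'p, 'a) rule set"
  superiority :: "('l \<times> 'l) set"

definition defeasible_theory ::
  "'c set \<Rightarrow> ('p \<Rightarrow> nat) \<Rightarrow> ('l, 'p, 'c trm) dtheory \<Rightarrow> bool" where
  "defeasible_theory C ar T \<longleftrightarrow>
     finite (facts T) \<and> facts T \<subseteq> lits_over ar (terms_over C) \<and>
     finite (rules T) \<and>
     (\<forall>r\<in>rules T. finite (antecedent r) \<and>
        antecedent r \<subseteq> lits_over ar (terms_over C) \<and>
        head r \<in> lits_over ar (terms_over C)) \<and>
     superiority T \<subseteq> (label ` rules T) \<times> (label ` rules T) \<and>
     acyclic (superiority T)"

definition strict_rules :: "('l, 'p, 'a) dtheory \<Rightarrow> ('p, 'a) lit \<Rightarrow> ('l, 'p, 'a) rule set" where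
  "strict_rules T q = {r \<in> rules T. head r = q \<and> kind r = Strict}"

definition sd_rules :: "('l, 'p, 'a) dtheory \<Rightarrow> ('p, 'a) lit \<Rightarrow> ('l, 'p, 'a) rule set" where
  "sd_rules T q = {r \<in> rules T. head r = q \<and> (kind r = Strict \<or> kind r = Defeasible)}"

definition all_rules :: "('l, 'p, 'a) dtheory \<Rightarrow> ('p, 'a) lit \<Rightarrow> ('l, 'p, 'a) rule set" where
  "all_rules T q = {r \<in> rules T. head r = q}"

definition superior :: "('l, 'p, 'a) dtheory \<Rightarrow> ('l, 'p, 'a) rule \<Rightarrow> ('l, 'p, 'a) rule \<Rightarrow> bool" where
  "superior T t s \<longleftrightarrow> (label t, label s) \<in> superiority T"

fun map_rule_args :: "('a \<Rightarrow> 'b) \<Rightarrow> ('l, 'p, 'a) rule \<Rightarrow> ('l, 'p, 'b) rule" where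
  "map_rule_args f (Rule l k A q) = Rule l k (map_lit id f ` A) (map_lit id f q)"

definition rule_args :: "('l, 'p, 'a) rule \<Rightarrow> 'a set" where
  "rule_args r = args (head r) \<union> (\<Union>a\<in>antecedent r. args a)"

fun instantiate :: "(nat \<Rightarrow> 'c) \<Rightarrow> 'c trm \<Rightarrow> 'c" where
  "instantiate \<sigma> (Var x) = \<sigma> x"
| "instantiate \<sigma> (Const a) = a"

text \<open>
  Ground instances over the constants in \<open>C\<close>. The substitution is constrained only on the
  variables that occur, so ground literals and rules are kept even if \<open>C\<close> is empty. All
  instances of a rule carry its label.
\<close>

definition ground_theory :: "'c set \<Rightarrow> ('l, 'p, 'c trm) dtheory \<Rightarrow> ('l, 'p, 'c) dtheory" where
  "ground_theory C T =
     \<lparr> facts = {map_lit id (instantiate \<sigma>) f | f \<sigma>. f \<in> facts T \<and> (\<forall>x. Var x \<in> args f \<longrightarrow> \<sigma> x \<in> C)},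
       rules = {map_rule_args (instantiate \<sigma>) r | r \<sigma>.
                  r \<in> rules T \<and> (\<forall>x. Var x \<in> rule_args r \<longrightarrow> \<sigma> x \<in> C)},
       superiority = superiority T \<rparr>"


section \<open>Proof theory\<close>

datatype 'q conclusion =
    PlusDelta (concl_lit: 'q)
  | MinusDelta (concl_lit: 'q)
  | PlusPartial (concl_lit: 'q)
  | MinusPartial (concl_lit: 'q)

fun justified ::
  "('l, 'p, 'a) dtheory \<Rightarrow> ('p, 'a) lit conclusion set \<Rightarrow> ('p, 'a) lit conclusion \<Rightarrow> bool" where
  "justified T P (PlusDelta q) \<longleftrightarrow>
     q \<in> facts T \<or> (\<exists>r\<in>strict_rules T q. \<forall>a\<in>antecedent r. PlusDelta a \<in> P)"
| "justified T P (MinusDelta q) \<longleftrightarrow>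
     q \<notin> facts T \<and> (\<forall>r\<in>strict_rules T q. \<exists>a\<in>antecedent r. MinusDelta a \<in> P)"
| "justified T P (PlusPartial q) \<longleftrightarrow>
     PlusDelta q \<in> P \<or>
     ((\<exists>r\<in>sd_rules T q. \<forall>a\<in>antecedent r. PlusPartial a \<in> P) \<and>
      MinusDelta (compl q) \<in> P \<and>
      (\<forall>s\<in>all_rules T (compl q).
         (\<exists>a\<in>antecedent s. MinusPartial a \<in> P) \<or>
         (\<exists>t\<in>sd_rules T q. (\<forall>a\<in>antecedent t. PlusPartial a \<in> P) \<and> superior T t s)))"
| "justified T P (MinusPartial q) \<longleftrightarrow>
     MinusDelta q \<in> P \<and>
     ((\<forall>r\<in>sd_rules T q. \<exists>a\<in>antecedent r. MinusPartial a \<in> P) \<or>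
      PlusDelta (compl q) \<in> P \<or>
      (\<exists>s\<in>all_rules T (compl q).
         (\<forall>a\<in>antecedent s. PlusPartial a \<in> P) \<and>
         (\<forall>t\<in>sd_rules T q. (\<exists>a\<in>antecedent t. MinusPartial a \<in> P) \<or> \<not> superior T t s)))"

definition derivation ::
  "'c set \<Rightarrow> ('p \<Rightarrow> nat) \<Rightarrow> ('l, 'p, 'c trm) dtheory \<Rightarrow> ('p, 'c) lit conclusion list \<Rightarrow> bool" where
  "derivation C ar T P \<longleftrightarrow>
     (\<forall>i<length P. concl_lit (P ! i) \<in> ground_lits ar C \<and>
        justified (ground_theory C T) (set (take i P)) (P ! i))"

definition derives ::
  "'c set \<Rightarrow> ('p \<Rightarrow> nat) \<Rightarrow> ('l, 'p, 'c trm) dtheory \<Rightarrow> ('p, 'c) lit conclusion \<Rightarrow> bool" where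
  "derives C ar T c \<longleftrightarrow> (\<exists>P. derivation C ar T P \<and> P \<noteq> [] \<and> last P = c)"


section \<open>Model theory\<close>

definition denote :: "('c, 'd) struct \<Rightarrow> ('p, 'c) lit \<Rightarrow> ('p, 'd) lit" where
  "denote D = map_lit id (interp D)"

text \<open>
  The theory that a ground theory denotes over a domain: a literal is a fact of it iff some ground
  fact denotes it, and its rules are the ground rules with head and antecedent interpreted.
\<close>

definition denote_theory :: "('c, 'd) struct \<Rightarrow> ('l, 'p, 'c) dtheory \<Rightarrow> ('l, 'p, 'd) dtheory" where
  "denote_theory D T =
     \<lparr> facts = denote D ` facts T,
       rules = map_rule_args (interp D) ` rules T,
       superiority = superiority T \<rparr>"

record ('c, 'p, 'd) dinterp =
  domain :: "('c, 'd) struct"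
  I_Delta :: "('p, 'd) lit \<rightharpoonup> bool"
  I_partial :: "('p, 'd) lit \<rightharpoonup> bool"

definition defeasible_interpretation ::
  "'c set \<Rightarrow> ('p \<Rightarrow> nat) \<Rightarrow> ('c, 'p, 'd) dinterp \<Rightarrow> bool" where
  "defeasible_interpretation C ar I \<longleftrightarrow>
     is_struct C (domain I) \<and>
     dom (I_Delta I) \<subseteq> base ar (domain I) \<and>
     dom (I_partial I) \<subseteq> base ar (domain I) \<and>
     (\<forall>q\<in>base ar (domain I).
        (I_Delta I q = Some True \<longrightarrow> I_partial I q = Some True) \<and>
        (I_partial I q = Some False \<longrightarrow> I_Delta I q = Some False))"

definition kleene_conj :: "('q \<rightharpoonup> bool) \<Rightarrow> 'q set \<Rightarrow> bool option" where
  "kleene_conj v A =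
     (if \<forall>a\<in>A. v a = Some True then Some True
      else if \<exists>a\<in>A. v a = Some False then Some False
      else None)"

definition model_conditions ::
  "('l, 'p, 'd) dtheory \<Rightarrow> (('p, 'd) lit \<rightharpoonup> bool) \<Rightarrow> (('p, 'd) lit \<rightharpoonup> bool) \<Rightarrow> ('p, 'd) lit \<Rightarrow> bool" where
  "model_conditions T vD vP q \<longleftrightarrow>
     (vD q = Some True \<longleftrightarrow>
        q \<in> facts T \<or> (\<exists>r\<in>strict_rules T q. kleene_conj vD (antecedent r) = Some True)) \<and>
     (vD q = Some False \<longleftrightarrow>
        q \<notin> facts T \<and> (\<forall>r\<in>strict_rules T q. kleene_conj vD (antecedent r) = Some False)) \<and>
     (vP q = Some True \<longleftrightarrow>
        vD q = Some True \<or>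
        ((\<exists>r\<in>sd_rules T q. kleene_conj vP (antecedent r) = Some True) \<and>
         vD (compl q) = Some False \<and>
         (\<forall>s\<in>all_rules T (compl q).
            kleene_conj vP (antecedent s) = Some False \<or>
            (\<exists>t\<in>sd_rules T q. kleene_conj vP (antecedent t) = Some True \<and> superior T t s)))) \<and>
     (vP q = Some False \<longleftrightarrow>
        vD q = Some False \<and>
        ((\<forall>r\<in>sd_rules T q. kleene_conj vP (antecedent r) = Some False) \<or>
         vD (compl q) = Some True \<or>
         (\<exists>s\<in>all_rules T (compl q).
            kleene_conj vP (antecedent s) = Some True \<and>
            (\<forall>t\<in>sd_rules T q. kleene_conj vP (antecedent t) = Some False \<or> \<not> superior T t s))))"

definition defeasible_model ::
  "'c set \<Rightarrow> ('p \<Rightarrow> nat) \<Rightarrow> ('l, 'p, 'c trm) dtheory \<Rightarrow> ('c, 'p, 'd) dinterp \<Rightarrow> bool" where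
  "defeasible_model C ar T M \<longleftrightarrow>
     defeasible_interpretation C ar M \<and>
     (\<forall>q\<in>base ar (domain M).
        model_conditions (denote_theory (domain M) (ground_theory C T)) (I_Delta M) (I_partial M) q)"

fun holds :: "('c, 'p, 'd) dinterp \<Rightarrow> ('p, 'c) lit conclusion \<Rightarrow> bool" where
  "holds M (PlusDelta q) \<longleftrightarrow> I_Delta M (denote (domain M) q) = Some True"
| "holds M (MinusDelta q) \<longleftrightarrow> I_Delta M (denote (domain M) q) = Some False"
| "holds M (PlusPartial q) \<longleftrightarrow> I_partial M (denote (domain M) q) = Some True"
| "holds M (MinusPartial q) \<longleftrightarrow> I_partial M (denote (domain M) q) = Some False"

text \<open>
  The first argument fixes the type from which the carriers of the models are drawn; a theorem
  about \<open>entails_DL TYPE('m)\<close> with free \<open>'m\<close> covers all models.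
\<close>

definition entails_DL ::
  "'m itself \<Rightarrow> 'c set \<Rightarrow> ('p \<Rightarrow> nat) \<Rightarrow> 'c fm set \<Rightarrow> ('l, 'p, 'c trm) dtheory \<Rightarrow>
     ('p, 'c) lit conclusion \<Rightarrow> bool" where
  "entails_DL _ C ar \<Gamma> T c \<longleftrightarrow>
     (\<forall>M :: ('c, 'p, 'm) dinterp.
        defeasible_model C ar T M \<and> (\<forall>\<phi>\<in>\<Gamma>. satisfies (domain M) \<phi>) \<longrightarrow> holds M c)"


section \<open>Unique names\<close>

definition occurring_consts ::
  "'c set \<Rightarrow> ('l, 'p, 'c trm) dtheory \<Rightarrow> ('p, 'c) lit conclusion \<Rightarrow> 'c set" where
  "occurring_consts C T c =
     (\<Union>f\<in>facts (ground_theory C T). args f) \<union>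
     (\<Union>r\<in>rules (ground_theory C T). rule_args r) \<union>
     args (concl_lit c)"

text \<open>
  Derivations compare ground literals syntactically, whereas models identify literals with equal
  denotations. Without unique names, conclusions other than \<open>+\<Delta> q\<close> may depend on the absence
  of facts or rules and are then unsound in general: if \<open>p(b)\<close> is the
  only fact and there are no rules, then \<open>-\<Delta> p(a)\<close> is derivable, but \<open>p(a)\<close> is definitely true in
  every model whose domain satisfies \<open>a = b\<close>.
\<close>

definition unique_names :: "('c, 'd) struct \<Rightarrow> 'c set \<Rightarrow> bool" where
  "unique_names D X \<longleftrightarrow> inj_on (interp D) X"

end

theory Submission
  imports Defs
begin

text \<open>
  Soundness is proved by induction along the derivation: each inference rule mirrors one
  direction of the corresponding model condition. Unique names for the constants occurring in
  the theory and in the conclusion belong to \<open>Th(D)\<close> as disequations, so they hold in every model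
  considered, and there the denoted theory has the same facts and rules for a denoted literal as
  the ground theory has for the literal itself. A derivation may mention constants
  outside this set; the induction is therefore restricted to literals over it, which is
  enough because an inference only consults antecedents of rules and complements.
\<close>

section \<open>Induction along derivations\<close>

text \<open>Complete induction on positions, since everything consulted at position \<open>i\<close>
  occurs earlier. The step sees the initial segment only as a set \<open>Q\<close> whose members
  satisfy \<open>\<Phi>\<close>.\<close>

lemma derivation_induct [consumes 2, case_names justified]:
  assumes "derivation C ar T P" "d \<in> set P"
    and step: "\<And>Q e. concl_lit e \<in> ground_lits ar C \<Longrightarrow> justified (ground_theory C T) Q e \<Longrightarrow>
      (\<And>e'. e' \<in> Q \<Longrightarrow> \<Phi> e') \<Longrightarrow> \<Phi> e"
  shows "\<Phi> d"
proof -
  have "\<Phi> (P ! i)" if "i < length P" for i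
    using that
  proof (induction i rule: less_induct)
    case (less i)
    show ?case
    proof (rule step)
      show "concl_lit (P ! i) \<in> ground_lits ar C"
        and "justified (ground_theory C T) (set (take i P)) (P ! i)"
        using assms(1) less.prems by (auto simp: derivation_def)
      show "\<Phi> e'" if "e' \<in> set (take i P)" for e'
        using that less by (auto simp: in_set_conv_nth)
    qed
  qed
  then show ?thesis
    using assms(2) by (auto simp: in_set_conv_nth)
qed

section \<open>Kleene conjunction and denotation of literals\<close>

lemma kleene_conj_True_iff: "kleene_conj v A = Some True \<longleftrightarrow> (\<forall>a\<in>A. v a = Some True)"
  by (auto simp: kleene_conj_def)

lemma kleene_conj_False_iff: "kleene_conj v A = Some False \<longleftrightarrow> (\<exists>a\<in>A. v a = Some False)"
  by (auto simp: kleene_conj_def)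

text \<open>The conjunction depends only on which values occur, so it does no harm if
  \<open>f\<close> merges elements of \<open>A\<close>.\<close>

lemma kleene_conj_image: "kleene_conj v (f ` A) = kleene_conj (v \<circ> f) A"
  by (simp add: kleene_conj_def)

lemma map_rule_args_sel [simp]:
  "label (map_rule_args f r) = label r"
  "kind (map_rule_args f r) = kind r"
  "antecedent (map_rule_args f r) = map_lit id f ` antecedent r"
  "head (map_rule_args f r) = map_lit id f (head r)"
  by (cases r; simp)+

lemma args_compl [simp]: "args (compl q) = args q"
  by (cases q) auto

lemma compl_denote: "compl (denote D q) = denote D (compl q)"
  by (cases q) (auto simp: denote_def)

lemma lits_over_args: "q \<in> lits_over ar X \<Longrightarrow> args q \<subseteq> X"
  by (auto simp: lits_over_def)

lemma denote_in_base:
  "is_struct C D \<Longrightarrow> q \<in> ground_lits ar C \<Longrightarrow> denote D q \<in> base ar D"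
  by (fastforce simp: lits_over_def denote_def is_struct_def)

lemma denote_inject:
  assumes "unique_names D X" "args p \<subseteq> X" "args q \<subseteq> X"
  shows "denote D p = denote D q \<longleftrightarrow> p = q"
proof -
  \<comment> \<open>Denotation keeps sign and predicate symbol, so only the argument lists remain to
    be compared; \<open>inj_on_map_eq_map\<close> asks for injectivity on the union of their
    elements.\<close>
  have "inj_on (interp D) (args p \<union> args q)"
    using assms by (auto simp: unique_names_def intro: inj_on_subset)
  then show ?thesis
    by (cases p; cases q) (auto simp: denote_def inj_on_map_eq_map)
qed

section \<open>Transfer between a ground theory and its denotation\<close>

text \<open>\<open>X\<close> is left open because two choices occur later: all of \<open>C\<close>,
  and \<open>occurring_consts\<close>.\<close>

definition theory_over :: "'a set \<Rightarrow> ('l, 'p, 'a) dtheory \<Rightarrow> bool" where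
  "theory_over X G \<longleftrightarrow> (\<forall>f\<in>facts G. args f \<subseteq> X) \<and> (\<forall>r\<in>rules G. rule_args r \<subseteq> X)"

text \<open>Ground literals with equal denotations would pool their facts and rules. Injectivity on
  \<open>X\<close> excludes this: the rules for a denoted literal are exactly the images of the
  rules for the literal, and the valuations can be pulled back along \<open>denote\<close>.\<close>

lemma model_conditions_denote:
  assumes "unique_names D X" "theory_over X G" "args q \<subseteq> X"
  shows "model_conditions (denote_theory D G) vD vP (denote D q) \<longleftrightarrow>
    model_conditions G (vD \<circ> denote D) (vP \<circ> denote D) q"
proof -
  let ?m = "map_rule_args (interp D)"
  have heads: "args (head r) \<subseteq> X" if "r \<in> rules G" for r
    using assms(2) that by (auto simp: theory_over_def rule_args_def)
  have inj: "map_lit id (interp D) (head r) = denote D p \<longleftrightarrow> head r = p"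
    if "r \<in> rules G" "args p \<subseteq> X" for r p
    using denote_inject[OF assms(1) heads[OF that(1)] that(2)] by (simp add: denote_def)
  \<comment> \<open>Stated for every \<open>p\<close> over \<open>X\<close>, since the condition at
    \<open>q\<close> inspects the rules for both \<open>q\<close> and
    \<open>compl q\<close>.\<close>
  have rules:
    "strict_rules (denote_theory D G) (denote D p) = ?m ` strict_rules G p"
    "sd_rules (denote_theory D G) (denote D p) = ?m ` sd_rules G p"
    "all_rules (denote_theory D G) (denote D p) = ?m ` all_rules G p"
    if "args p \<subseteq> X" for p
    using inj[OF _ that]
    by (auto simp: strict_rules_def sd_rules_def all_rules_def denote_theory_def)
  have facts: "denote D q \<in> facts (denote_theory D G) \<longleftrightarrow> q \<in> facts G"
    using denote_inject[OF assms(1) _ assms(3)] assms(2)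
    unfolding denote_theory_def theory_over_def by (simp add: image_iff) metis
  have sup: "superior (denote_theory D G) (?m t) (?m s) \<longleftrightarrow> superior G t s" for t s
    by (simp add: superior_def denote_theory_def)
  have kc: "kleene_conj v (antecedent (?m r)) = kleene_conj (v \<circ> denote D) (antecedent r)" for v r
    by (simp add: kleene_conj_image denote_def)
  have "args (compl q) \<subseteq> X"
    using assms(3) by simp
  then show ?thesis
    \<comment> \<open>\<open>map_rule_args_sel\<close> would rewrite
      \<open>antecedent (?m r)\<close> before \<open>kc\<close> could match.\<close>
    by (simp add: model_conditions_def rules assms(3) facts sup kc compl_denote
        del: map_rule_args_sel)
qed

section \<open>Soundness of a single inference\<close>

text \<open>With the valuations pulled back, proof rules and model conditions speak of the same
  ground rules, so each clause of \<open>justified\<close> yields the right-hand side of one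
  biconditional.\<close>

lemma justified_holds:
  assumes "theory_over X G" "justified G P d" "args (concl_lit d) \<subseteq> X"
    and IH: "\<And>e. e \<in> P \<Longrightarrow> args (concl_lit e) \<subseteq> X \<Longrightarrow> holds M e"
    and mc: "model_conditions G (I_Delta M \<circ> denote (domain M)) (I_partial M \<circ> denote (domain M))
      (concl_lit d)"
  shows "holds M d"
proof -
  let ?vD = "\<lambda>p. I_Delta M (denote (domain M) p)"
  let ?vP = "\<lambda>p. I_partial M (denote (domain M) p)"
  have antecedents: "args a \<subseteq> X" if "r \<in> rules G" "a \<in> antecedent r" for r a
    using assms(1) that unfolding theory_over_def rule_args_def by blast
  have IH':
    "PlusDelta a \<in> P \<Longrightarrow> args a \<subseteq> X \<Longrightarrow> ?vD a = Some True"
    "MinusDelta a \<in> P \<Longrightarrow> args a \<subseteq> X \<Longrightarrow> ?vD a = Some False"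
    "PlusPartial a \<in> P \<Longrightarrow> args a \<subseteq> X \<Longrightarrow> ?vP a = Some True"
    "MinusPartial a \<in> P \<Longrightarrow> args a \<subseteq> X \<Longrightarrow> ?vP a = Some False" for a
    using IH[of "PlusDelta a"] IH[of "MinusDelta a"] IH[of "PlusPartial a"] IH[of "MinusPartial a"]
    by simp_all
  have ante:
    "\<forall>a\<in>antecedent r. PlusDelta a \<in> P \<Longrightarrow> kleene_conj ?vD (antecedent r) = Some True"
    "\<exists>a\<in>antecedent r. MinusDelta a \<in> P \<Longrightarrow> kleene_conj ?vD (antecedent r) = Some False"
    "\<forall>a\<in>antecedent r. PlusPartial a \<in> P \<Longrightarrow> kleene_conj ?vP (antecedent r) = Some True"
    "\<exists>a\<in>antecedent r. MinusPartial a \<in> P \<Longrightarrow> kleene_conj ?vP (antecedent r) = Some False"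
    if "r \<in> rules G" for r
    using antecedents[OF that] by (auto simp: kleene_conj_True_iff kleene_conj_False_iff intro!: IH' bexI)
  have sub: "r \<in> strict_rules G p \<Longrightarrow> r \<in> rules G" "r \<in> sd_rules G p \<Longrightarrow> r \<in> rules G"
    "r \<in> all_rules G p \<Longrightarrow> r \<in> rules G" for r p
    by (auto simp: strict_rules_def sd_rules_def all_rules_def)
  \<comment> \<open>The four conjuncts are the biconditionals for +\<Delta>, -\<Delta>, +\<partial>
    and -\<partial>, in this order; each case rewrites its goal with its own.\<close>
  note mc' = mc[unfolded model_conditions_def o_def]
  show ?thesis
  proof (cases d)
    case (PlusDelta q)
    have "?vD q = Some True"
      unfolding mc'[unfolded PlusDelta conclusion.sel, THEN conjunct1]
      using assms(2) ante(1) sub(1) unfolding PlusDelta justified.simps by meson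
    then show ?thesis
      by (simp add: PlusDelta)
  next
    case (MinusDelta q)
    have "?vD q = Some False"
      unfolding mc'[unfolded MinusDelta conclusion.sel, THEN conjunct2, THEN conjunct1]
      using assms(2) ante(2) sub(1) unfolding MinusDelta justified.simps by meson
    then show ?thesis
      by (simp add: MinusDelta)
  next
    case (PlusPartial q)
    have q: "args q \<subseteq> X" "args (compl q) \<subseteq> X"
      using assms(3) PlusPartial by simp_all
    note V = mc'[unfolded PlusPartial conclusion.sel, THEN conjunct2, THEN conjunct2, THEN conjunct1]
    have "?vP q = Some True"
      using assms(2) unfolding PlusPartial justified.simps
    proof (elim disjE conjE)
      assume "PlusDelta q \<in> P"
      then show ?thesis
        unfolding V using IH'(1) q(1) by simp
    next
      assume "\<exists>r\<in>sd_rules G q. \<forall>a\<in>antecedent r. PlusPartial a \<in> P"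
      then have 1: "\<exists>r\<in>sd_rules G q. kleene_conj ?vP (antecedent r) = Some True"
        using ante(3) sub(2) by meson
      assume "MinusDelta (compl q) \<in> P"
      then have 2: "?vD (compl q) = Some False"
        using IH'(2) q(2) by blast
      assume rebut: "\<forall>s\<in>all_rules G (compl q). (\<exists>a\<in>antecedent s. MinusPartial a \<in> P) \<or>
        (\<exists>t\<in>sd_rules G q. (\<forall>a\<in>antecedent t. PlusPartial a \<in> P) \<and> superior G t s)"
      \<comment> \<open>Each attacking rule \<open>s\<close> is either discarded or beaten by a
        superior applicable rule \<open>t\<close>.\<close>
      have "kleene_conj ?vP (antecedent s) = Some False \<or>
          (\<exists>t\<in>sd_rules G q. kleene_conj ?vP (antecedent t) = Some True \<and> superior G t s)"
        if s: "s \<in> all_rules G (compl q)" for s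
        using bspec[OF rebut s] ante(4)[OF sub(3)[OF s]] ante(3)[OF sub(2)] by meson
      with 1 2 show ?thesis
        unfolding V by simp
    qed
    then show ?thesis
      by (simp add: PlusPartial)
  next
    case (MinusPartial q)
    have q: "args q \<subseteq> X" "args (compl q) \<subseteq> X"
      using assms(3) MinusPartial by simp_all
    note V = mc'[unfolded MinusPartial conclusion.sel, THEN conjunct2, THEN conjunct2, THEN conjunct2]
    from assms(2) have "MinusDelta q \<in> P"
      by (simp add: MinusPartial)
    then have strict: "?vD q = Some False"
      using IH'(2) q(1) by blast
    from assms(2) consider "\<forall>r\<in>sd_rules G q. \<exists>a\<in>antecedent r. MinusPartial a \<in> P"
      | "PlusDelta (compl q) \<in> P"
      | s where "s \<in> all_rules G (compl q)" "\<forall>a\<in>antecedent s. PlusPartial a \<in> P"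
        "\<forall>t\<in>sd_rules G q. (\<exists>a\<in>antecedent t. MinusPartial a \<in> P) \<or> \<not> superior G t s"
      unfolding MinusPartial justified.simps by blast
    then have "?vP q = Some False"
    proof cases
      case 1
      then have "\<forall>r\<in>sd_rules G q. kleene_conj ?vP (antecedent r) = Some False"
        using ante(4) sub(2) by meson
      with strict show ?thesis
        unfolding V by simp
    next
      case 2
      with strict show ?thesis
        unfolding V using IH'(1) q(2) by simp
    next
      case 3
      have "kleene_conj ?vP (antecedent s) = Some True"
        using 3(2) ante(3)[OF sub(3)[OF 3(1)]] by simp
      moreover have "\<forall>t\<in>sd_rules G q. kleene_conj ?vP (antecedent t) = Some False \<or>
          \<not> superior G t s"
        using 3(3) ante(4)[OF sub(2)] by meson
      ultimately show ?thesis
        unfolding V using strict 3(1) by auto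
    qed
    then show ?thesis
      by (simp add: MinusPartial)
  qed
qed

text \<open>This inference only asserts that a fact or an applicable strict rule exists. Denotation
  preserves both, and facts or rules added by coinciding names do no harm, so the denoted theory can
  be used directly.\<close>

lemma justified_PlusDelta_holds:
  assumes "justified G P (PlusDelta q)"
    and "\<And>a. PlusDelta a \<in> P \<Longrightarrow> holds M (PlusDelta a)"
    and "model_conditions (denote_theory (domain M) G) (I_Delta M) (I_partial M)
      (denote (domain M) q)"
  shows "holds M (PlusDelta q)"
proof -
  let ?D = "domain M"
  from assms(1) consider "q \<in> facts G"
    | r where "r \<in> strict_rules G q" "\<forall>a\<in>antecedent r. PlusDelta a \<in> P"
    by auto
  then have "denote ?D q \<in> facts (denote_theory ?D G) \<or>
    (\<exists>r\<in>strict_rules (denote_theory ?D G) (denote ?D q).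
       kleene_conj (I_Delta M) (antecedent r) = Some True)"
  proof cases
    case 1
    then show ?thesis
      by (simp add: denote_theory_def)
  next
    case 2
    then have "map_rule_args (interp ?D) r \<in> strict_rules (denote_theory ?D G) (denote ?D q)"
      by (auto simp: strict_rules_def denote_theory_def denote_def)
    moreover have
      "kleene_conj (I_Delta M) (antecedent (map_rule_args (interp ?D) r)) = Some True"
      using 2(2) assms(2) by (auto simp: kleene_conj_True_iff denote_def)
    ultimately show ?thesis
      by blast
  qed
  then show ?thesis
    using assms(3) by (simp add: model_conditions_def)
qed

section \<open>Constants of the ground theory and unique names\<close>

lemma args_instantiate:
  assumes "args q \<subseteq> terms_over C" "\<forall>x. Var x \<in> args q \<longrightarrow> \<sigma> x \<in> C"
  shows "args (map_lit id (instantiate \<sigma>) q) \<subseteq> C"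
  using assms by (fastforce simp: lit.set_map terms_over_def)

lemma ground_theory_over:
  assumes "defeasible_theory C ar T"
  shows "theory_over C (ground_theory C T)"
proof -
  have facts: "args f \<subseteq> terms_over C" if "f \<in> facts T" for f
    using assms that by (auto simp: defeasible_theory_def dest: lits_over_args)
  have rules: "args (head r) \<subseteq> terms_over C \<and> (\<forall>a\<in>antecedent r. args a \<subseteq> terms_over C)"
    if "r \<in> rules T" for r
    using assms that unfolding defeasible_theory_def by (meson lits_over_args subsetD)
  have "args g \<subseteq> C" if "g \<in> facts (ground_theory C T)" for g
    using that facts args_instantiate by (fastforce simp: ground_theory_def)
  moreover have "rule_args (map_rule_args (instantiate \<sigma>) r) \<subseteq> C"
    if r: "r \<in> rules T" and \<sigma>: "\<forall>x. Var x \<in> rule_args r \<longrightarrow> \<sigma> x \<in> C" for r \<sigma>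
  proof -
    have "args (map_lit id (instantiate \<sigma>) q) \<subseteq> C" if "q = head r \<or> q \<in> antecedent r" for q
      using that rules[OF r] \<sigma> by (intro args_instantiate) (auto simp: rule_args_def)
    then show ?thesis
      by (auto simp: rule_args_def)
  qed
  then have "rule_args g \<subseteq> C" if "g \<in> rules (ground_theory C T)" for g
    using that unfolding ground_theory_def by force
  ultimately show ?thesis
    by (simp add: theory_over_def)
qed

lemma theory_over_occurring_consts: "theory_over (occurring_consts C T c) (ground_theory C T)"
  by (auto simp: theory_over_def occurring_consts_def)

text \<open>Ensures that disequations between occurring constants are sentences over
  \<open>C\<close>, as membership in \<open>Th C D\<close> requires.\<close>

lemma occurring_consts_subset:
  assumes "defeasible_theory C ar T" "concl_lit c \<in> ground_lits ar C"
  shows "occurring_consts C T c \<subseteq> C"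
  using ground_theory_over[OF assms(1)] lits_over_args[OF assms(2)]
  by (auto simp: occurring_consts_def theory_over_def)

lemma unique_names_Th:
  assumes "unique_names D X" "X \<subseteq> C" "carrier E \<noteq> {}" "\<forall>\<phi>\<in>Th C D. satisfies E \<phi>"
  shows "unique_names E X"
  unfolding unique_names_def
proof (rule inj_onI, rule ccontr)
  fix a b
  assume ab: "a \<in> X" "b \<in> X" "interp E a = interp E b" "a \<noteq> b"
  then have "interp D a \<noteq> interp D b"
    using assms(1) by (auto simp: unique_names_def inj_on_def)
  then have "FNot (FEqual (Const a) (Const b)) \<in> Th C D"
    using ab assms(2) by (auto simp: Th_def sentences_def satisfies_def)
  then have "satisfies E (FNot (FEqual (Const a) (Const b)))"
    using assms(4) by blast
  \<comment> \<open>\<open>satisfies\<close> quantifies over assignments into the carrier; the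
    constant assignment to \<open>d\<close> keeps this from being vacuous.\<close>
  moreover obtain d where "d \<in> carrier E"
    using assms(3) by blast
  ultimately show False
    using ab(3) by (auto simp: satisfies_def dest: spec[of _ "\<lambda>_. d"])
qed

section \<open>Soundness of whole derivations\<close>

lemma defeasible_modelD:
  assumes "defeasible_model C ar T M"
  shows "is_struct C (domain M)"
    and "q \<in> ground_lits ar C \<Longrightarrow>
      model_conditions (denote_theory (domain M) (ground_theory C T)) (I_Delta M) (I_partial M)
        (denote (domain M) q)"
proof -
  show struct: "is_struct C (domain M)"
    using assms unfolding defeasible_model_def defeasible_interpretation_def by blast
  show "model_conditions (denote_theory (domain M) (ground_theory C T)) (I_Delta M) (I_partial M)
    (denote (domain M) q)" if "q \<in> ground_lits ar C"
    using assms denote_in_base[OF struct that] unfolding defeasible_model_def by blast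
qed

lemma derivation_sound_PlusDelta:
  assumes "derivation C ar T P" "PlusDelta q \<in> set P" "defeasible_model C ar T M"
  shows "holds M (PlusDelta q)"
proof -
  \<comment> \<open>The induction runs through all conclusions of \<open>P\<close>, with a vacuous
    claim for the other tags.\<close>
  have "\<forall>a. d = PlusDelta a \<longrightarrow> holds M (PlusDelta a)" if "d \<in> set P" for d
    using assms(1) that
  proof (induction rule: derivation_induct)
    case (justified Q e)
    show ?case
    proof (intro allI impI)
      fix a
      assume e: "e = PlusDelta a"
      show "holds M (PlusDelta a)"
      proof (rule justified_PlusDelta_holds)
        show "justified (ground_theory C T) Q (PlusDelta a)"
          using justified.hyps(2) by (simp only: e)
        show "holds M (PlusDelta b)" if "PlusDelta b \<in> Q" for b
          using justified.IH[OF that] by blast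
        show "model_conditions (denote_theory (domain M) (ground_theory C T))
          (I_Delta M) (I_partial M) (denote (domain M) a)"
          using defeasible_modelD(2)[OF assms(3) justified.hyps(1)] by (simp only: e conclusion.sel)
      qed
    qed
  qed
  then show ?thesis
    using assms(2) by simp
qed

lemma derivation_sound_unique_names:
  assumes "derivation C ar T P" "d \<in> set P" "defeasible_model C ar T M"
    and "theory_over X (ground_theory C T)" "unique_names (domain M) X"
    and "args (concl_lit d) \<subseteq> X"
  shows "holds M d"
proof -
  \<comment> \<open>The restriction to \<open>X\<close> becomes part of the induction predicate:
    nothing is claimed about entries of \<open>P\<close> that mention other constants.\<close>
  have "args (concl_lit d) \<subseteq> X \<longrightarrow> holds M d"
    using assms(1,2)
  proof (induction rule: derivation_induct)
    case (justified Q e)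
    show ?case
    proof
      assume e: "args (concl_lit e) \<subseteq> X"
      show "holds M e"
      proof (rule justified_holds[OF assms(4) justified.hyps(2) e])
        show "holds M d'" if "d' \<in> Q" "args (concl_lit d') \<subseteq> X" for d'
          using justified.IH[OF that(1)] that(2) by blast
        show "model_conditions (ground_theory C T) (I_Delta M \<circ> denote (domain M))
          (I_partial M \<circ> denote (domain M)) (concl_lit e)"
          using defeasible_modelD(2)[OF assms(3) justified.hyps(1)]
          unfolding model_conditions_denote[OF assms(5,4) e] .
      qed
    qed
  qed
  then show ?thesis
    using assms(6) by blast
qed

theorem theorem1:
  fixes C :: "'c set"
    and ar :: "'p \<Rightarrow> nat"
    and T :: "('l, 'p, 'c trm) dtheory"
    and D :: "('c, 'd) struct"
    and c :: "('p, 'c) lit conclusion"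
  assumes "defeasible_theory C ar T"
    and "is_struct C D"
    and "concl_lit c \<in> ground_lits ar C"
    and "(\<exists>q. c = PlusDelta q) \<or> unique_names D (occurring_consts C T c)"
    and "derives C ar T c"
  shows "entails_DL TYPE('m) C ar (Th C D) T c"
  unfolding entails_DL_def
proof (intro allI impI, elim conjE)
  fix M :: "('c, 'p, 'm) dinterp"
  assume M: "defeasible_model C ar T M" and Th: "\<forall>\<phi>\<in>Th C D. satisfies (domain M) \<phi>"
  obtain P where P: "derivation C ar T P" "c \<in> set P"
    using assms(5) by (auto simp: derives_def)
  from assms(4) show "holds M c"
  proof
    assume "\<exists>q. c = PlusDelta q"
    then obtain q where c: "c = PlusDelta q"
      by blast
    show ?thesis
      unfolding c by (rule derivation_sound_PlusDelta[OF P[unfolded c] M])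
  next
    assume un: "unique_names D (occurring_consts C T c)"
    have "carrier (domain M) \<noteq> {}"
      using defeasible_modelD(1)[OF M] by (simp add: is_struct_def)
    \<comment> \<open>\<open>M\<close> may have a different carrier type from \<open>D\<close>; the
      names stay distinct because the disequations true in \<open>D\<close> carry over through
      \<open>Th C D\<close>.\<close>
    then have "unique_names (domain M) (occurring_consts C T c)"
      by (rule unique_names_Th[OF un occurring_consts_subset[OF assms(1,3)] _ Th])
    moreover have "args (concl_lit c) \<subseteq> occurring_consts C T c"
      unfolding occurring_consts_def by blast
    ultimately show ?thesis
      by (rule derivation_sound_unique_names[OF P M theory_over_occurring_consts])
  qed
qed

end
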